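(* Let $\Lambda_j,\Gamma_j\in\mathcal L(\mathcal U,\mathcal V_j)$ and let $u_{j,k}=\Lambda_j^*e_{j,k}$, $v_{j,k}=\Gamma_j^*e_{j,k}$, where $\{e_{j,k}:k\in\mathbb K_j\}$ is an orthonormal basis for $\mathcal V_j$ and $\mathbb K_j$ is a subset of $\mathbb Z$ $(j\in J)$. Then $(\Lambda,\Gamma)=(\{\Lambda_j\}_{j\in J},\{\Gamma_j\}_{j\in J})$ is a bi-$g$-frame (respectively bi-$g$-Bessel sequence, tight bi-$g$-frame) for $\mathcal U$ with respect to $\{\mathcal V_j\}_{j\in J}$ if and only if $\left(\{u_{j,k}\}_{j\in J,k\in\mathbb K_j},\{v_{j,k}\}_{j\in J,k\in\mathbb K_j}\right)$ is a biframe (respectively biBessel sequence, tight biframe) for $\mathcal U$.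
   Context: $\mathcal U$ and $\mathcal V$ are Hilbert spaces, $J$ is a subset of $\mathbb Z$, and $\{\mathcal V_j\}_{j\in J}$ is a sequence of closed subspaces of $\mathcal V$. $\mathcal L(\mathcal U,\mathcal V_j)$ is the collection of all bounded linear operators from $\mathcal U$ into $\mathcal V_j$. A pair $(\Lambda,\Gamma)=(\{\Lambda_j\}_{j\in J},\{\Gamma_j\}_{j\in J})$ of sequences with $\Lambda_j,\Gamma_j\in\mathcal L(\mathcal U,\mathcal V_j)$ is called a bi-$g$-frame for $\mathcal U$ with respect to $\{\mathcal V_j\}_{j\in J}$ if there exist positive constants $C$ and $D$ such that $$C\|f\|^2\le\sum_{j\in J}\langle\Lambda_j f,\Gamma_j f\rangle\le D\|f\|^2\qquad(f\in\mathcal U),$$ where the inner products are those of the $\mathcal V_j$. If only the right-hand inequality is satisfied, $(\Lambda,\Gamma)$ is called a bi-$g$-Bessel sequence; if $C=D$, it is called a tight bi-$g$-frame. A pair $(\{f_j\},\{g_j\})$ of sequences in $\mathcal U$ with the same countable index set is called a biframe for $\mathcal U$ if there exist positive constants $c$ and $d$ such that $$c\|f\|^2\le\sum_{j}\langle f,f_j\rangle\langle g_j,f\rangle\le d\|f\|^2\qquad(f\in\mathcal U),$$ the sum being over the index set. If only the right-hand inequality is satisfied it is called a biBessel sequence; if $c=d$, a tight biframe. In the theorem the index set is $\{(j,k):j\in J,\ k\in\mathbb K_j\}$.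
   Formalization: In the biframe, biBessel and tight biframe conditions, the sum over the index set of pairs (j,k) is taken as an iterated sum, over j of the sum over k; as a single series over the pairs it may diverge for a tight bi-g-frame, so the equivalence would fail. *)

theory Defs
  imports "HOL-Analysis.Analysis" "HOL-Library.Complex_Order"
begin

(* Complex Hilbert spaces.  The inner product is linear in the first argument. *)

class complex_inner = real_normed_vector +
  fixes scaleC :: "complex \<Rightarrow> 'a \<Rightarrow> 'a"
    and cinner :: "'a \<Rightarrow> 'a \<Rightarrow> complex"
  assumes scaleC_add_right: "scaleC a (x + y) = scaleC a x + scaleC a y"
    and scaleC_add_left: "scaleC (a + b) x = scaleC a x + scaleC b x"
    and scaleC_scaleC: "scaleC a (scaleC b x) = scaleC (a * b) x"
    and scaleC_of_real: "scaleC (complex_of_real r) x = r *\<^sub>R x"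
    and cinner_commute: "cinner x y = cnj (cinner y x)"
    and cinner_add_left: "cinner (x + y) z = cinner x z + cinner y z"
    and cinner_scaleC_left: "cinner (scaleC a x) y = a * cinner x y"
    and cinner_self: "cinner x x = complex_of_real ((norm x)\<^sup>2)"

class chilbert_space = complex_inner + complete_space

instantiation complex :: chilbert_space
begin

definition scaleC_complex :: "complex \<Rightarrow> complex \<Rightarrow> complex"
  where "scaleC_complex a x = a * x"

definition cinner_complex :: "complex \<Rightarrow> complex \<Rightarrow> complex"
  where "cinner_complex x y = x * cnj y"

instance
proof
  fix a b x y z :: complex and r :: real
  show "cinner x x = complex_of_real ((norm x)\<^sup>2)"
    by (simp only: cinner_complex_def complex_norm_square)
qed (simp_all add: scaleC_complex_def cinner_complex_def algebra_simps scaleR_conv_of_real)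

end

global_interpretation complex_vector: vector_space
  "scaleC :: complex \<Rightarrow> 'a \<Rightarrow> 'a::complex_inner"
  defines csubspace = complex_vector.subspace
    and cspan = complex_vector.span
proof
  fix x :: 'a
  show "scaleC 1 x = x"
    using scaleC_of_real[of 1 x] by simp
qed (simp_all add: scaleC_add_right scaleC_add_left scaleC_scaleC)

definition closed_csubspace :: "'a::complex_inner set \<Rightarrow> bool"
  where "closed_csubspace W \<longleftrightarrow> csubspace W \<and> closed W"

definition bounded_operators_into ::
    "'v::complex_inner set \<Rightarrow> ('u::complex_inner \<Rightarrow> 'v) set"
  where "bounded_operators_into W =
    {T. Vector_Spaces.linear scaleC scaleC T \<and> (\<exists>B. \<forall>f. norm (T f) \<le> B * norm f) \<and> range T \<subseteq> W}"

(* For T in L(U,W) with W a closed subspace of V, the inner product of W is the restriction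
   of that of V, so on W this is the adjoint of T regarded as an operator from U into W. *)
definition cadjoint ::
    "('u::complex_inner \<Rightarrow> 'v::complex_inner) \<Rightarrow> 'v \<Rightarrow> 'u"
  where "cadjoint T w = (THE g. \<forall>f. cinner (T f) w = cinner f g)"

definition orthonormal_basis_of ::
    "'v::complex_inner set \<Rightarrow> 'k set \<Rightarrow> ('k \<Rightarrow> 'v) \<Rightarrow> bool"
  where "orthonormal_basis_of W K e \<longleftrightarrow>
    (\<forall>k\<in>K. \<forall>l\<in>K. cinner (e k) (e l) = (if k = l then 1 else 0)) \<and>
    closure (cspan (e ` K)) = W"

(* Bounds on complex sums are in the order of Complex_Order: z \<le> w means Re z \<le> Re w and
   Im z = Im w, so each inequality includes the assertion that the sum is real.  Each
   definition also requires the series to converge. *)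

definition operator_pair ::
    "'j set \<Rightarrow> ('j \<Rightarrow> 'v set) \<Rightarrow> ('j \<Rightarrow> 'u::complex_inner \<Rightarrow> 'v::complex_inner)
      \<Rightarrow> ('j \<Rightarrow> 'u \<Rightarrow> 'v) \<Rightarrow> bool"
  where "operator_pair J V \<Lambda> \<Gamma> \<longleftrightarrow>
    (\<forall>j\<in>J. \<Lambda> j \<in> bounded_operators_into (V j) \<and> \<Gamma> j \<in> bounded_operators_into (V j))"

definition bi_g_frame ::
    "'j set \<Rightarrow> ('j \<Rightarrow> 'v set) \<Rightarrow> ('j \<Rightarrow> 'u::complex_inner \<Rightarrow> 'v::complex_inner)
      \<Rightarrow> ('j \<Rightarrow> 'u \<Rightarrow> 'v) \<Rightarrow> bool"
  where "bi_g_frame J V \<Lambda> \<Gamma> \<longleftrightarrow> operator_pair J V \<Lambda> \<Gamma> \<and>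
    (\<exists>C>0. \<exists>D>0. \<forall>f. \<exists>S. ((\<lambda>j. cinner (\<Lambda> j f) (\<Gamma> j f)) has_sum S) J \<and>
      complex_of_real (C * (norm f)\<^sup>2) \<le> S \<and> S \<le> complex_of_real (D * (norm f)\<^sup>2))"

definition bi_g_bessel ::
    "'j set \<Rightarrow> ('j \<Rightarrow> 'v set) \<Rightarrow> ('j \<Rightarrow> 'u::complex_inner \<Rightarrow> 'v::complex_inner)
      \<Rightarrow> ('j \<Rightarrow> 'u \<Rightarrow> 'v) \<Rightarrow> bool"
  where "bi_g_bessel J V \<Lambda> \<Gamma> \<longleftrightarrow> operator_pair J V \<Lambda> \<Gamma> \<and>
    (\<exists>D>0. \<forall>f. \<exists>S. ((\<lambda>j. cinner (\<Lambda> j f) (\<Gamma> j f)) has_sum S) J \<and>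
      S \<le> complex_of_real (D * (norm f)\<^sup>2))"

definition tight_bi_g_frame ::
    "'j set \<Rightarrow> ('j \<Rightarrow> 'v set) \<Rightarrow> ('j \<Rightarrow> 'u::complex_inner \<Rightarrow> 'v::complex_inner)
      \<Rightarrow> ('j \<Rightarrow> 'u \<Rightarrow> 'v) \<Rightarrow> bool"
  where "tight_bi_g_frame J V \<Lambda> \<Gamma> \<longleftrightarrow> operator_pair J V \<Lambda> \<Gamma> \<and>
    (\<exists>C>0. \<forall>f. \<exists>S. ((\<lambda>j. cinner (\<Lambda> j f) (\<Gamma> j f)) has_sum S) J \<and>
      complex_of_real (C * (norm f)\<^sup>2) \<le> S \<and> S \<le> complex_of_real (C * (norm f)\<^sup>2))"

(* Sum over the index set {(j,k). j \<in> J, k \<in> K j}, taken as sum over j of the sum over k.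
   The order matters: unconditional summation over the pairs is strictly stronger (cf.
   has_sum_imp_has_double_sum), and with it a tight bi-g-frame need not yield a biframe.
   Take U = C, V_0 = C with both operators the identity, and for each j \<ge> 1 the space
   V_j = C^2 with the operators f \<mapsto> (f,f) and f \<mapsto> (f,-f): the g-sum is |f|^2, whereas the
   family over the pairs has infinitely many terms |f|^2 and infinitely many -|f|^2. *)
definition has_double_sum ::
    "('j \<Rightarrow> 'k \<Rightarrow> complex) \<Rightarrow> complex \<Rightarrow> 'j set \<Rightarrow> ('j \<Rightarrow> 'k set) \<Rightarrow> bool"
  where "has_double_sum a S J K \<longleftrightarrow>
    (\<exists>s. (\<forall>j\<in>J. (a j has_sum s j) (K j)) \<and> (s has_sum S) J)"

lemma has_sum_imp_has_double_sum:
  assumes sum: "((\<lambda>(j, k). a j k) has_sum S) (Sigma J K)"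
  shows "has_double_sum a S J K"
proof -
  have "(\<lambda>(j, k). a j k) summable_on Sigma J K"
    using sum by (rule has_sum_imp_summable)
  then have "(a j has_sum infsum (a j) (K j)) (K j)" if "j \<in> J" for j
    using that by (rule has_sum_infsum[OF summable_on_SigmaD1])
  then have rows: "((\<lambda>k. (\<lambda>(j, k). a j k) (j, k)) has_sum infsum (a j) (K j)) (K j)"
    if "j \<in> J" for j
    unfolding prod.case using that .
  have "((\<lambda>j. infsum (a j) (K j)) has_sum S) J"
    by (rule has_sum_SigmaD[OF sum rows])
  then show ?thesis
    unfolding has_double_sum_def using rows
    by (intro exI[of _ "\<lambda>j. infsum (a j) (K j)"] conjI ballI) simp_all
qed

definition biframe ::
    "'j set \<Rightarrow> ('j \<Rightarrow> 'k set) \<Rightarrow> ('j \<Rightarrow> 'k \<Rightarrow> 'u::complex_inner) \<Rightarrow> ('j \<Rightarrow> 'k \<Rightarrow> 'u) \<Rightarrow> bool"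
  where "biframe J K u v \<longleftrightarrow>
    (\<exists>c>0. \<exists>d>0. \<forall>f. \<exists>S. has_double_sum (\<lambda>j k. cinner f (u j k) * cinner (v j k) f) S J K \<and>
      complex_of_real (c * (norm f)\<^sup>2) \<le> S \<and> S \<le> complex_of_real (d * (norm f)\<^sup>2))"

definition bibessel ::
    "'j set \<Rightarrow> ('j \<Rightarrow> 'k set) \<Rightarrow> ('j \<Rightarrow> 'k \<Rightarrow> 'u::complex_inner) \<Rightarrow> ('j \<Rightarrow> 'k \<Rightarrow> 'u) \<Rightarrow> bool"
  where "bibessel J K u v \<longleftrightarrow>
    (\<exists>d>0. \<forall>f. \<exists>S. has_double_sum (\<lambda>j k. cinner f (u j k) * cinner (v j k) f) S J K \<and>
      S \<le> complex_of_real (d * (norm f)\<^sup>2))"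

definition tight_biframe ::
    "'j set \<Rightarrow> ('j \<Rightarrow> 'k set) \<Rightarrow> ('j \<Rightarrow> 'k \<Rightarrow> 'u::complex_inner) \<Rightarrow> ('j \<Rightarrow> 'k \<Rightarrow> 'u) \<Rightarrow> bool"
  where "tight_biframe J K u v \<longleftrightarrow>
    (\<exists>c>0. \<forall>f. \<exists>S. has_double_sum (\<lambda>j k. cinner f (u j k) * cinner (v j k) f) S J K \<and>
      complex_of_real (c * (norm f)\<^sup>2) \<le> S \<and> S \<le> complex_of_real (c * (norm f)\<^sup>2))"

end

theory Submission
  imports Defs
begin

text \<open>
  The adjoint identity turns \<open>\<langle>f, u\<^sub>j\<^sub>k\<rangle>\<langle>v\<^sub>j\<^sub>k, f\<rangle>\<close> into \<open>\<langle>\<Lambda>\<^sub>j f, e\<^sub>j\<^sub>k\<rangle>\<langle>e\<^sub>j\<^sub>k, \<Gamma>\<^sub>j f\<rangle>\<close>, whose sum over \<open>k\<close> is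
  \<open>\<langle>\<Lambda>\<^sub>j f, \<Gamma>\<^sub>j f\<rangle>\<close> by Parseval's identity in \<open>V\<^sub>j\<close>.  So the two systems have the same sums for
  every \<open>f\<close>, and the three equivalences hold with the same constants.  Adjoints exist by the Riesz
  representation theorem: the representing vector minimizes \<open>\<parallel>g\<parallel>\<^sup>2 - 2 Re (\<phi> g)\<close>, and the
  parallelogram law makes minimizing sequences Cauchy.
\<close>

section \<open>Complex inner products\<close>

lemma scaleC_minus1: "scaleC (-1) x = - (x::'a::complex_inner)"
  using scaleC_of_real[of "-1" x] by simp

lemma cinner_add_right: "cinner x (y + z) = cinner x y + cinner x (z::'a::complex_inner)"
  by (metis cinner_add_left cinner_commute complex_cnj_add)

lemma cinner_scaleC_right: "cinner x (scaleC a y) = cnj a * cinner x (y::'a::complex_inner)"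
  by (metis cinner_scaleC_left cinner_commute complex_cnj_mult)

lemma cinner_minus_left: "cinner (- x) y = - cinner x (y::'a::complex_inner)"
  using cinner_scaleC_left[of "-1" x y] by (simp add: scaleC_minus1)

lemma cinner_minus_right: "cinner x (- y) = - cinner x (y::'a::complex_inner)"
  using cinner_scaleC_right[of x "-1" y] by (simp add: scaleC_minus1)

lemma cinner_diff_left: "cinner (x - y) z = cinner x z - cinner y (z::'a::complex_inner)"
  using cinner_add_left[of x "- y" z] by (simp add: cinner_minus_left)

lemma cinner_diff_right: "cinner x (y - z) = cinner x y - cinner x (z::'a::complex_inner)"
  using cinner_add_right[of x y "- z"] by (simp add: cinner_minus_right)

lemma cinner_zero_left [simp]: "cinner 0 (x::'a::complex_inner) = 0"
  using cinner_diff_left[of x x x] by simp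

lemma cinner_zero_right [simp]: "cinner (x::'a::complex_inner) 0 = 0"
  using cinner_diff_right[of x x x] by simp

lemma cinner_sum_left:
  "cinner (\<Sum>k\<in>F. f k) (y::'a::complex_inner) = (\<Sum>k\<in>F. cinner (f k) y)"
  by (induction F rule: infinite_finite_induct) (simp_all add: cinner_add_left)

lemma Re_cinner_commute: "Re (cinner x y) = Re (cinner y (x::'a::complex_inner))"
  by (subst cinner_commute) simp

lemma power2_norm_add:
  "(norm (x + y))\<^sup>2 = (norm x)\<^sup>2 + 2 * Re (cinner x y) + (norm (y::'a::complex_inner))\<^sup>2"
proof -
  have "Re (cinner (x + y) (x + y))
      = Re (cinner x x) + (Re (cinner x y) + Re (cinner y x)) + Re (cinner y y)"
    by (simp add: cinner_add_left cinner_add_right)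
  then show ?thesis
    by (simp add: cinner_self Re_cinner_commute[of y x])
qed

lemma parallelogram_law:
  "(norm (x + y))\<^sup>2 + (norm (x - y))\<^sup>2 = 2 * (norm x)\<^sup>2 + 2 * (norm (y::'a::complex_inner))\<^sup>2"
  using power2_norm_add[of x y] power2_norm_add[of x "- y"] by (simp add: cinner_minus_right)

lemma norm_scaleC: "norm (scaleC a (x::'a::complex_inner)) = cmod a * norm x"
proof -
  have "complex_of_real ((norm (scaleC a x))\<^sup>2) = (a * cnj a) * cinner x x"
    unfolding cinner_self[symmetric] by (simp add: cinner_scaleC_left cinner_scaleC_right)
  also have "\<dots> = complex_of_real ((cmod a * norm x)\<^sup>2)"
    unfolding power_mult_distrib of_real_mult complex_norm_square cinner_self ..
  finally have "(norm (scaleC a x))\<^sup>2 = (cmod a * norm x)\<^sup>2"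
    using of_real_eq_iff by blast
  then show ?thesis
    by simp
qed

text \<open>Positivity of the squared norm of \<open>x + scaleC c y\<close>, for the
  \<open>c\<close> that removes from \<open>x\<close> its component along \<open>y\<close>.\<close>

lemma cinner_Cauchy_Schwarz: "cmod (cinner x y) \<le> norm x * norm (y::'a::complex_inner)"
proof (cases "y = 0")
  case False
  define n where "n = (norm y)\<^sup>2"
  have n: "n > 0"
    using False by (simp add: n_def)
  define c where "c = - (cinner x y / of_real n)"
  have "Re (cinner x (scaleC c y)) = Re (cnj c * cinner x y)"
    by (simp add: cinner_scaleC_right)
  also have "cnj c * cinner x y = - (of_real ((cmod (cinner x y))\<^sup>2) / of_real n)"
    unfolding c_def complex_norm_square by simp
  also have "Re \<dots> = - ((cmod (cinner x y))\<^sup>2 / n)"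
    by (metis Re_complex_of_real of_real_divide of_real_minus)
  finally have re: "Re (cinner x (scaleC c y)) = - ((cmod (cinner x y))\<^sup>2 / n)" .
  have "(norm (scaleC c y))\<^sup>2 = (cmod (cinner x y))\<^sup>2 / n"
    using n by (simp add: norm_scaleC c_def norm_divide power_mult_distrib power_divide
        n_def[symmetric] power2_eq_square[of n])
  then have "0 \<le> (norm x)\<^sup>2 - (cmod (cinner x y))\<^sup>2 / n"
    using re power2_norm_add[of x "scaleC c y"] zero_le_power2[of "norm (x + scaleC c y)"]
    by linarith
  then have "(cmod (cinner x y))\<^sup>2 \<le> (norm x * norm y)\<^sup>2"
    using n by (simp add: field_simps n_def)
  then show ?thesis
    by (rule power2_le_imp_le) simp
qed simp

text \<open>Cauchy-Schwarz supplies the bound; this continuity later carries the inner product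
  through an infinite sum.\<close>

lemma bounded_linear_cinner_left: "bounded_linear (\<lambda>x. cinner x (y::'a::complex_inner))"
proof (rule bounded_linear_intro)
  show "cinner (r *\<^sub>R x) y = r *\<^sub>R cinner x y" for r x
    using cinner_scaleC_left[of "of_real r" x y] by (simp add: scaleC_of_real scaleR_conv_of_real)
qed (rule cinner_add_left cinner_Cauchy_Schwarz)+

lemma cinner_ext:
  assumes "\<And>f. cinner f g = cinner f (h::'a::complex_inner)"
  shows "g = h"
proof -
  have "cinner (g - h) (g - h) = 0"
    using assms[of "g - h"] by (simp add: cinner_diff_right)
  then show ?thesis
    by (simp add: cinner_self)
qed

section \<open>Riesz representation and adjoints\<close>

text \<open>The shape of bound that the parallelogram law yields for a minimizing sequence, with
  \<open>a n\<close> the excess over the infimum up to a factor.\<close>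

lemma Cauchy_of_power2_dist_le:
  fixes X :: "nat \<Rightarrow> 'a::metric_space"
  assumes "\<And>m n. (dist (X m) (X n))\<^sup>2 \<le> a m + a n" and "a \<longlonglongrightarrow> 0"
  shows "Cauchy X"
proof (rule metric_CauchyI)
  fix d :: real
  assume d: "0 < d"
  then have "eventually (\<lambda>n. a n < d\<^sup>2 / 2) sequentially"
    using order_tendstoD(2)[OF assms(2), of "d\<^sup>2 / 2"] by simp
  then obtain N where N: "\<And>n. n \<ge> N \<Longrightarrow> a n < d\<^sup>2 / 2"
    by (auto simp: eventually_sequentially)
  have "dist (X m) (X n) < d" if "m \<ge> N" "n \<ge> N" for m n
  proof (rule power2_less_imp_less)
    show "(dist (X m) (X n))\<^sup>2 < d\<^sup>2"
      using assms(1)[of m n] N[OF that(1)] N[OF that(2)] by linarith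
  qed (use d in simp)
  then show "\<exists>N. \<forall>m\<ge>N. \<forall>n\<ge>N. dist (X m) (X n) < d"
    by blast
qed

text \<open>The minimizer of \<open>q\<close> represents \<phi>, because the first-order condition
  at the minimum is equality of the real parts of \<phi> and of the inner product with
  \<open>g\<close>.\<close>

lemma riesz_representation:
  fixes \<phi> :: "'a::chilbert_space \<Rightarrow> complex"
  assumes add: "\<And>x y. \<phi> (x + y) = \<phi> x + \<phi> y"
    and scale: "\<And>a x. \<phi> (scaleC a x) = a * \<phi> x"
    and bound: "\<And>x. cmod (\<phi> x) \<le> B * norm x"
  shows "\<exists>g. \<forall>f. \<phi> f = cinner f g"
proof -
  have scaleR: "\<phi> (r *\<^sub>R x) = r *\<^sub>R \<phi> x" for r x
    using scale[of "of_real r" x] by (simp add: scaleC_of_real scaleR_conv_of_real)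
  have bl: "bounded_linear \<phi>"
    using bound by (intro bounded_linear_intro[where K = B]) (simp_all add: add scaleR mult.commute)
  define q where "q g = (norm g)\<^sup>2 - 2 * Re (\<phi> g)" for g
  \<comment> \<open>Completing the square in \<open>norm g\<close> bounds \<open>q\<close> from
    below, so its infimum is meaningful.\<close>
  have low: "- B\<^sup>2 \<le> q g" for g
  proof -
    have "Re (\<phi> g) \<le> B * norm g"
      using bound[of g] complex_Re_le_cmod[of "\<phi> g"] by linarith
    moreover have "0 \<le> (norm g - B)\<^sup>2"
      by simp
    ultimately show ?thesis
      unfolding q_def power2_diff by (simp add: mult.commute)
  qed
  define m where "m = Inf (range q)"
  have bdd: "bdd_below (range q)"
    using low by (intro bdd_belowI) auto
  have m_le: "m \<le> q g" for g
    unfolding m_def using bdd by (intro cInf_lower) auto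
  have "\<exists>g. q g < m + inverse (real (Suc n))" for n
  proof -
    have "Inf (range q) < m + inverse (real (Suc n))"
      by (simp add: m_def)
    then show ?thesis
      using bdd by (subst (asm) cInf_less_iff) auto
  qed
  then obtain X where X: "\<And>n. q (X n) < m + inverse (real (Suc n))"
    by metis
  \<comment> \<open>The midpoint \<open>z\<close> satisfies \<open>m \<le> q z\<close>, and the
    parallelogram law says that the left side equals
    \<open>2 * q x + 2 * q y - 4 * q z\<close>.\<close>
  have mid: "(norm (x - y))\<^sup>2 \<le> 2 * q x + 2 * q y - 4 * m" for x y
  proof -
    define z where "z = (1/2) *\<^sub>R (x + y)"
    have "4 * q z = (norm (x + y))\<^sup>2 - 4 * (Re (\<phi> x) + Re (\<phi> y))"
      unfolding q_def z_def norm_scaleR scaleR by (simp add: add power_mult_distrib power_divide field_simps)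
    then show ?thesis
      using m_le[of z] parallelogram_law[of x y] q_def[of x] q_def[of y]
      by (simp add: algebra_simps)
  qed
  have "Cauchy X"
  proof (rule Cauchy_of_power2_dist_le)
    show "(dist (X i) (X n))\<^sup>2 \<le> 2 * inverse (real (Suc i)) + 2 * inverse (real (Suc n))" for i n
      using mid[of "X i" "X n"] X[of i] X[of n] unfolding dist_norm by simp
    show "(\<lambda>n. 2 * inverse (real (Suc n))) \<longlonglongrightarrow> 0"
      using tendsto_mult_left[OF LIMSEQ_inverse_real_of_nat, of 2] by simp
  qed
  then obtain g where g: "X \<longlonglongrightarrow> g"
    using Cauchy_convergent convergent_def by blast
  have "(\<lambda>n. q (X n)) \<longlonglongrightarrow> q g"
    unfolding q_def
    by (intro tendsto_intros g bounded_linear.tendsto[OF bl g])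
  moreover have "(\<lambda>n. m + inverse (real (Suc n))) \<longlonglongrightarrow> m + 0"
    by (intro tendsto_intros LIMSEQ_inverse_real_of_nat)
  ultimately have "q g \<le> m + 0"
    by (rule LIMSEQ_le) (use X less_imp_le in blast)
  then have min: "q g \<le> q x" for x
    using m_le[of x] by simp
  have re: "Re (\<phi> x) = Re (cinner x g)" for x
  proof -
    define r where "r = Re (cinner x g) - Re (\<phi> x)"
    \<comment> \<open>Perturbing \<open>g\<close> by \<open>t *\<^sub>R x\<close> changes
      \<open>q\<close> by \<open>2 * t * r + t\<^sup>2 * (norm x)\<^sup>2\<close>. For this
      \<open>t\<close> the change is \<open>- t\<^sup>2 * ((norm x)\<^sup>2 + 2)\<close>, so
      minimality forces \<open>t = 0\<close> and hence \<open>r = 0\<close>. The added 1 keeps the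
      denominator positive at \<open>x = 0\<close>.\<close>
    define t where "t = - r / ((norm x)\<^sup>2 + 1)"
    have n: "(norm x)\<^sup>2 + 1 > 0"
      by (simp add: add_nonneg_pos)
    have "Re (cinner g (t *\<^sub>R x)) = t * Re (cinner x g)"
      by (simp add: Re_cinner_commute[of g] scaleC_of_real[symmetric] cinner_scaleC_left)
    then have "q (g + t *\<^sub>R x) = q g + 2 * t * r + t\<^sup>2 * (norm x)\<^sup>2"
      by (simp add: q_def power2_norm_add add scaleR r_def power_mult_distrib algebra_simps)
    then have "0 \<le> 2 * t * r + t\<^sup>2 * (norm x)\<^sup>2"
      using min[of "g + t *\<^sub>R x"] by simp
    moreover have "r = - t * ((norm x)\<^sup>2 + 1)"
      using n by (simp add: t_def)
    ultimately have "0 \<le> - (t\<^sup>2 * ((norm x)\<^sup>2 + 2))"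
      by (simp add: power2_eq_square algebra_simps)
    moreover have "(norm x)\<^sup>2 + 2 > 0"
      by (simp add: add_nonneg_pos)
    ultimately have "t = 0"
      by (simp add: mult_le_0_iff)
    then show ?thesis
      using n by (simp add: t_def r_def)
  qed
  \<comment> \<open>Both sides are complex linear in \<open>x\<close>, and multiplying by
    \<open>\<i>\<close> turns an imaginary part into minus a real part.\<close>
  have "Im (\<phi> x) = Im (cinner x g)" for x
    using re[of "scaleC \<i> x"] by (simp add: scale cinner_scaleC_left)
  with re show ?thesis
    by (metis complex_eqI)
qed

text \<open>The description in \<open>cadjoint\<close> denotes: Riesz representation gives
  existence, and \<open>cinner_ext\<close> gives uniqueness.\<close>

lemma cinner_cadjoint:
  fixes T :: "'u::chilbert_space \<Rightarrow> 'v::complex_inner"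
  assumes "T \<in> bounded_operators_into W"
  shows "cinner f (cadjoint T w) = cinner (T f) w"
proof -
  have lin: "Vector_Spaces.linear scaleC scaleC T"
    using assms by (simp add: bounded_operators_into_def)
  interpret T: Vector_Spaces.linear scaleC scaleC T
    by (rule lin)
  obtain B where B: "\<And>f. norm (T f) \<le> B * norm f"
    using assms by (auto simp: bounded_operators_into_def)
  have "\<exists>g. \<forall>f. cinner (T f) w = cinner f g"
  proof (rule riesz_representation)
    show "cmod (cinner (T x) w) \<le> (B * norm w) * norm x" for x
      using cinner_Cauchy_Schwarz[of "T x" w] mult_right_mono[OF B[of x], of "norm w"]
      by (simp add: mult_ac)
  qed (simp_all add: T.add T.scale cinner_add_left cinner_scaleC_left)
  then obtain g where g: "\<forall>f. cinner (T f) w = cinner f g"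
    by blast
  have "cadjoint T w = g"
    unfolding cadjoint_def
  proof (rule the_equality)
    show "h = g" if "\<forall>f. cinner (T f) w = cinner f h" for h
      using that g by (simp add: cinner_ext)
  qed (rule g)
  then show ?thesis
    using g by simp
qed

section \<open>Orthonormal expansions\<close>

text \<open>The partial sum \<open>p\<close> is the orthogonal projection of \<open>x\<close> onto
  the span, so Pythagoras applies to \<open>x - w = (x - p) + (p - w)\<close>.\<close>

lemma orthonormal_partial_sum_closest:
  fixes e :: "'k \<Rightarrow> 'a::complex_inner"
  assumes F: "finite F"
    and on: "\<forall>k\<in>F. \<forall>l\<in>F. cinner (e k) (e l) = (if k = l then 1 else 0)"
    and w: "w \<in> cspan (e ` F)"
  shows "norm (x - (\<Sum>k\<in>F. scaleC (cinner x (e k)) (e k))) \<le> norm (x - w)"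
proof -
  define p where "p = (\<Sum>k\<in>F. scaleC (cinner x (e k)) (e k))"
  have ortho_e: "cinner (x - p) (e l) = 0" if "l \<in> F" for l
  proof -
    have "cinner p (e l) = (\<Sum>k\<in>F. cinner x (e k) * cinner (e k) (e l))"
      by (simp add: p_def cinner_sum_left cinner_scaleC_left)
    also have "\<dots> = (\<Sum>k\<in>F. if k = l then cinner x (e k) else 0)"
      using on that by (intro sum.cong) auto
    also have "\<dots> = cinner x (e l)"
      using F that by simp
    finally show ?thesis
      by (simp add: cinner_diff_left)
  qed
  have ortho: "cinner (x - p) z = 0" if "z \<in> cspan (e ` F)" for z
    using that
  proof (induction rule: complex_vector.span_induct)
    case base
    show ?case
      by (rule complex_vector.subspaceI) (simp_all add: cinner_add_right cinner_scaleC_right)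
  qed (use ortho_e in auto)
  have "p \<in> cspan (e ` F)"
    unfolding p_def
    by (intro complex_vector.span_sum complex_vector.span_scale complex_vector.span_base) auto
  then have "cinner (x - p) (p - w) = 0"
    using w by (intro ortho complex_vector.span_diff)
  then have "(norm (x - w))\<^sup>2 = (norm (x - p))\<^sup>2 + (norm (p - w))\<^sup>2"
    using power2_norm_add[of "x - p" "p - w"] by simp
  then have "(norm (x - p))\<^sup>2 \<le> (norm (x - w))\<^sup>2"
    by simp
  then show ?thesis
    unfolding p_def by (rule power2_le_imp_le) simp
qed

text \<open>Density of the span gives one finite combination close to \<open>x\<close>. By best
  approximation, the partial sum over any finite set containing its indices is at least as close,
  which is convergence along the net of finite subsets.\<close>

lemma orthonormal_expansion:
  fixes e :: "'k \<Rightarrow> 'a::complex_inner"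
  assumes "orthonormal_basis_of W K e" and x: "x \<in> W"
  shows "((\<lambda>k. scaleC (cinner x (e k)) (e k)) has_sum x) K"
proof -
  have on: "\<forall>k\<in>K. \<forall>l\<in>K. cinner (e k) (e l) = (if k = l then 1 else 0)"
    and cl: "closure (cspan (e ` K)) = W"
    using assms(1) by (auto simp: orthonormal_basis_of_def)
  show ?thesis
    unfolding has_sum_def tendsto_iff eventually_finite_subsets_at_top
  proof (intro allI impI)
    fix d :: real
    assume "0 < d"
    then obtain w where w: "w \<in> cspan (e ` K)" and dw: "dist w x < d"
      using x cl closure_approachable by blast
    obtain t r where t: "finite t" "t \<subseteq> e ` K" and weq: "w = (\<Sum>a\<in>t. scaleC (r a) a)"
      using w unfolding complex_vector.span_explicit by auto
    \<comment> \<open>The approximant is a combination of vectors; choosing finitely many indices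
      for them gives the threshold set of the net.\<close>
    obtain F where F: "F \<subseteq> K" "finite F" "t = e ` F"
      using finite_subset_image[OF t] by blast
    have wF: "w \<in> cspan (e ` F)"
      unfolding weq F(3)
      by (intro complex_vector.span_sum complex_vector.span_scale complex_vector.span_base)
    have "dist (\<Sum>k\<in>G. scaleC (cinner x (e k)) (e k)) x < d"
      if G: "finite G" "F \<subseteq> G" "G \<subseteq> K" for G
    proof -
      have "w \<in> cspan (e ` G)"
        using wF complex_vector.span_mono[OF image_mono[OF G(2)], of e] by blast
      then have "norm (x - (\<Sum>k\<in>G. scaleC (cinner x (e k)) (e k))) \<le> norm (x - w)"
        using G on by (intro orthonormal_partial_sum_closest) blast+
      then show ?thesis
        using dw by (simp add: dist_norm norm_minus_commute)
    qed
    then show "\<exists>X. finite X \<and> X \<subseteq> K \<and> (\<forall>Y. finite Y \<and> X \<subseteq> Y \<and> Y \<subseteq> K \<longrightarrow>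
        dist (\<Sum>k\<in>Y. scaleC (cinner x (e k)) (e k)) x < d)"
      using F by blast
  qed
qed

text \<open>The continuous functional \<open>\<lambda>x. cinner x y\<close> is applied termwise to
  the expansion of \<open>x\<close>.\<close>

lemma parseval_has_sum:
  fixes e :: "'k \<Rightarrow> 'a::complex_inner"
  assumes "orthonormal_basis_of W K e" and "x \<in> W"
  shows "((\<lambda>k. cinner x (e k) * cinner (e k) y) has_sum cinner x y) K"
  using has_sum_bounded_linear[OF bounded_linear_cinner_left[of y] orthonormal_expansion[OF assms]]
  by (simp add: cinner_scaleC_left o_def)

text \<open>Uniqueness of sums forces the existentially quantified row sums to agree with
  \<open>b\<close> on \<open>J\<close>, so only the outer sum remains.\<close>

lemma has_double_sum_iff_has_sum:
  assumes "\<And>j. j \<in> J \<Longrightarrow> (a j has_sum b j) (K j)"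
  shows "has_double_sum a S J K \<longleftrightarrow> (b has_sum S) J"
proof
  assume "has_double_sum a S J K"
  then obtain s where s: "\<forall>j\<in>J. (a j has_sum s j) (K j)" and S: "(s has_sum S) J"
    by (auto simp: has_double_sum_def)
  have "s j = b j" if "j \<in> J" for j
    using s assms that has_sum_unique by blast
  then show "(b has_sum S) J"
    using S has_sum_cong[of J s b] by simp
next
  assume "(b has_sum S) J"
  then show "has_double_sum a S J K"
    using assms by (auto simp: has_double_sum_def)
qed

theorem theorem3p1:
  fixes J :: "int set"
    and K :: "int \<Rightarrow> int set"
    and V :: "int \<Rightarrow> 'v::chilbert_space set"
    and \<Lambda> \<Gamma> :: "int \<Rightarrow> 'u::chilbert_space \<Rightarrow> 'v"
    and e :: "int \<Rightarrow> int \<Rightarrow> 'v"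
    and u v :: "int \<Rightarrow> int \<Rightarrow> 'u"
  assumes "\<And>j. j \<in> J \<Longrightarrow> closed_csubspace (V j)"
    and "\<And>j. j \<in> J \<Longrightarrow> \<Lambda> j \<in> bounded_operators_into (V j)"
    and "\<And>j. j \<in> J \<Longrightarrow> \<Gamma> j \<in> bounded_operators_into (V j)"
    and "\<And>j. j \<in> J \<Longrightarrow> orthonormal_basis_of (V j) (K j) (e j)"
    and "\<And>j k. j \<in> J \<Longrightarrow> k \<in> K j \<Longrightarrow> u j k = cadjoint (\<Lambda> j) (e j k)"
    and "\<And>j k. j \<in> J \<Longrightarrow> k \<in> K j \<Longrightarrow> v j k = cadjoint (\<Gamma> j) (e j k)"
  shows "(bi_g_frame J V \<Lambda> \<Gamma> \<longleftrightarrow> biframe J K u v) \<and>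
    (bi_g_bessel J V \<Lambda> \<Gamma> \<longleftrightarrow> bibessel J K u v) \<and>
    (tight_bi_g_frame J V \<Lambda> \<Gamma> \<longleftrightarrow> tight_biframe J K u v)"
proof -
  have rows: "((\<lambda>k. cinner f (u j k) * cinner (v j k) f) has_sum cinner (\<Lambda> j f) (\<Gamma> j f)) (K j)"
    if j: "j \<in> J" for f j
  proof -
    have "\<Lambda> j f \<in> V j"
      using assms(2)[OF j] by (auto simp: bounded_operators_into_def)
    then have "((\<lambda>k. cinner (\<Lambda> j f) (e j k) * cinner (e j k) (\<Gamma> j f))
        has_sum cinner (\<Lambda> j f) (\<Gamma> j f)) (K j)"
      by (rule parseval_has_sum[OF assms(4)[OF j]])
    \<comment> \<open>The first factor is the adjoint identity for \<Lambda>; the second is the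
      conjugate of the one for \<Gamma>.\<close>
    moreover have "cinner f (u j k) * cinner (v j k) f
        = cinner (\<Lambda> j f) (e j k) * cinner (e j k) (\<Gamma> j f)" if k: "k \<in> K j" for k
      using cinner_cadjoint[OF assms(2)[OF j], of f "e j k"]
        cinner_cadjoint[OF assms(3)[OF j], of f "e j k"]
        cinner_commute[of "v j k" f] cinner_commute[of "e j k" "\<Gamma> j f"]
      by (simp add: assms(5,6)[OF j k])
    ultimately show ?thesis
      by (subst has_sum_cong) auto
  qed
  have sums: "has_double_sum (\<lambda>j k. cinner f (u j k) * cinner (v j k) f) S J K \<longleftrightarrow>
      ((\<lambda>j. cinner (\<Lambda> j f) (\<Gamma> j f)) has_sum S) J" for f S
    by (rule has_double_sum_iff_has_sum) (rule rows)
  \<comment> \<open>Only the operator-side definitions contain this conjunct. Once it is discharged,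
    \<open>sums\<close> makes the two sides of each equivalence coincide.\<close>
  have "operator_pair J V \<Lambda> \<Gamma>"
    using assms(2,3) by (simp add: operator_pair_def)
  then show ?thesis
    unfolding bi_g_frame_def bi_g_bessel_def tight_bi_g_frame_def biframe_def bibessel_def
      tight_biframe_def sums by simp
qed

end
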